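(* Let $\mathcal{I}$ be the species of interval orders and let $\mathcal{R}\subseteq\mathcal{I}$ be the subspecies of rigid interval orders. Partitioning an interval order into indistinguishability classes (and equipping the set of classes with the induced order) gives a natural isomorphism $$\mathcal{I}=\mathcal{R}\circ E_+ .$$
   Context: A species is a functor from the category of finite sets and bijections to the category of finite sets and functions; equality of species means natural isomorphism. $\mathcal{I}[U]$ is the set of interval orders on the finite set $U$, i.e. irreflexive transitive relations on $U$ with no induced subposet isomorphic to the disjoint union of two two-element chains; transport is by relabeling. An interval order is rigid if its only automorphism is the identity. $E_+$ is the species of nonempty sets. An $(\mathcal{R}\circ E_+)$-structure on $U$ is a partition $\beta$ of $U$ into nonempty blocks together with a rigid interval order on the set $\beta$; transport is by relabeling. Two elements of a poset are indistinguishable if they have the same strict down-set $\{y:y<x\}$ and the same strict up-set $\{y:x<y\}$. Given $P\in\mathcal{I}[U]$ with partition $\beta$ into indistinguishability classes, the induced order $<_Q$ on $\beta$ is defined by $B<_QB'$ iff $x<_Py$ for some $x\in B$ and $y\in B'$; the isomorphism sends $P$ to $(\beta,<_Q)$. *)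

theory Defs
  imports "HOL-Library.Disjoint_Sets"
begin

text \<open>
  A species is given by a structure map \<open>F\<close>, sending a finite set to its set of structures, and a
  transport map \<open>t\<close>, sending a bijection to a function on structures. Both are meant to be
  polymorphic in the type of the underlying elements. Since arguments of a HOL constant are
  monomorphic, the functor laws are stated for the instances of \<open>F\<close> and \<open>t\<close> at three element
  types. A bijection from \<open>U\<close> to \<open>V\<close> is represented by a total function whose values outside \<open>U\<close>
  are irrelevant; the third clause makes transport depend only on the values on \<open>U\<close>.
\<close>

definition species ::
  "('a set \<Rightarrow> 'r set) \<Rightarrow> ('b set \<Rightarrow> 's set) \<Rightarrow> ('c set \<Rightarrow> 't set) \<Rightarrow>
   (('a \<Rightarrow> 'a) \<Rightarrow> 'r \<Rightarrow> 'r) \<Rightarrow> (('a \<Rightarrow> 'b) \<Rightarrow> 'r \<Rightarrow> 's) \<Rightarrow>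
   (('b \<Rightarrow> 'c) \<Rightarrow> 's \<Rightarrow> 't) \<Rightarrow> (('a \<Rightarrow> 'c) \<Rightarrow> 'r \<Rightarrow> 't) \<Rightarrow> bool"
  where
  "species F1 F2 F3 t11 t12 t23 t13 \<longleftrightarrow>
     (\<forall>U. finite U \<longrightarrow> finite (F1 U)) \<and>
     (\<forall>U V \<sigma>. finite U \<and> finite V \<and> bij_betw \<sigma> U V \<longrightarrow> (\<forall>s \<in> F1 U. t12 \<sigma> s \<in> F2 V)) \<and>
     (\<forall>U V \<sigma> \<tau>. finite U \<and> finite V \<and> bij_betw \<sigma> U V \<and> (\<forall>x \<in> U. \<sigma> x = \<tau> x) \<longrightarrow>
        (\<forall>s \<in> F1 U. t12 \<sigma> s = t12 \<tau> s)) \<and>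
     (\<forall>U. finite U \<longrightarrow> (\<forall>s \<in> F1 U. t11 id s = s)) \<and>
     (\<forall>U V W \<sigma> \<tau>. finite U \<and> finite V \<and> finite W \<and> bij_betw \<sigma> U V \<and> bij_betw \<tau> V W \<longrightarrow>
        (\<forall>s \<in> F1 U. t13 (\<tau> \<circ> \<sigma>) s = t23 \<tau> (t12 \<sigma> s)))"

text \<open>
  Likewise, \<open>F1\<close>, \<open>G1\<close>, \<open>\<alpha>1\<close> and \<open>F2\<close>, \<open>G2\<close>, \<open>\<alpha>2\<close> are the instances at two element types of the
  structure maps and of a family of maps from \<open>F\<close>-structures to \<open>G\<close>-structures.
\<close>

definition natural_isomorphism ::
  "('a set \<Rightarrow> 'r set) \<Rightarrow> ('b set \<Rightarrow> 's set) \<Rightarrow> (('a \<Rightarrow> 'b) \<Rightarrow> 'r \<Rightarrow> 's) \<Rightarrow>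
   ('a set \<Rightarrow> 'p set) \<Rightarrow> ('b set \<Rightarrow> 'q set) \<Rightarrow> (('a \<Rightarrow> 'b) \<Rightarrow> 'p \<Rightarrow> 'q) \<Rightarrow>
   ('a set \<Rightarrow> 'r \<Rightarrow> 'p) \<Rightarrow> ('b set \<Rightarrow> 's \<Rightarrow> 'q) \<Rightarrow> bool"
  where
  "natural_isomorphism F1 F2 t G1 G2 u \<alpha>1 \<alpha>2 \<longleftrightarrow>
     (\<forall>U. finite U \<longrightarrow> bij_betw (\<alpha>1 U) (F1 U) (G1 U)) \<and>
     (\<forall>V. finite V \<longrightarrow> bij_betw (\<alpha>2 V) (F2 V) (G2 V)) \<and>
     (\<forall>U V \<sigma>. finite U \<and> finite V \<and> bij_betw \<sigma> U V \<longrightarrow>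
        (\<forall>s \<in> F1 U. \<alpha>2 V (t \<sigma> s) = u \<sigma> (\<alpha>1 U s)))"

definition poset_iso :: "('a \<Rightarrow> 'b) \<Rightarrow> 'a set \<Rightarrow> 'a rel \<Rightarrow> 'b set \<Rightarrow> 'b rel \<Rightarrow> bool"
  where "poset_iso \<sigma> A r B s \<longleftrightarrow>
    bij_betw \<sigma> A B \<and> (\<forall>x \<in> A. \<forall>y \<in> A. (x, y) \<in> r \<longleftrightarrow> (\<sigma> x, \<sigma> y) \<in> s)"

text \<open>
  The disjoint union of two two-element chains, on \<^typ>\<open>bool \<times> bool\<close>: the first component selects
  the chain, the second the position in it.
\<close>

definition two_plus_two :: "(bool \<times> bool) rel"
  where "two_plus_two = {((i, False), (i, True)) | i. True}"

definition interval_orders :: "'a set \<Rightarrow> 'a rel set"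
  where "interval_orders U =
    {P. P \<subseteq> U \<times> U \<and> irrefl P \<and> trans P \<and>
        \<not> (\<exists>W \<sigma>. W \<subseteq> U \<and> poset_iso \<sigma> UNIV two_plus_two W (P \<inter> W \<times> W))}"

definition rigid :: "'a set \<Rightarrow> 'a rel \<Rightarrow> bool"
  where "rigid U P \<longleftrightarrow> (\<forall>\<sigma>. poset_iso \<sigma> U P U P \<longrightarrow> (\<forall>x \<in> U. \<sigma> x = x))"

definition rigid_interval_orders :: "'a set \<Rightarrow> 'a rel set"
  where "rigid_interval_orders U = {P \<in> interval_orders U. rigid U P}"

definition relabel :: "('a \<Rightarrow> 'b) \<Rightarrow> 'a rel \<Rightarrow> 'b rel"
  where "relabel \<sigma> P = map_prod \<sigma> \<sigma> ` P"

text \<open>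
  The composite \<open>F \<circ> E\<^sub>+\<close> with the species of nonempty sets. As each nonempty block carries
  exactly one \<open>E\<^sub>+\<close>-structure, a structure is a partition into nonempty blocks together with an
  \<open>F\<close>-structure on the set of blocks; \<open>F\<close> and \<open>t\<close> are taken at element types \<^typ>\<open>'a set\<close>,
  \<^typ>\<open>'b set\<close>.
\<close>

definition comp_E_plus :: "('a set set \<Rightarrow> 's set) \<Rightarrow> 'a set \<Rightarrow> ('a set set \<times> 's) set"
  where "comp_E_plus F U = {(\<beta>, s). partition_on U \<beta> \<and> s \<in> F \<beta>}"

definition comp_E_plus_transport ::
  "(('a set \<Rightarrow> 'b set) \<Rightarrow> 's \<Rightarrow> 't) \<Rightarrow> ('a \<Rightarrow> 'b) \<Rightarrow> 'a set set \<times> 's \<Rightarrow> 'b set set \<times> 't"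
  where "comp_E_plus_transport t \<sigma> = (\<lambda>(\<beta>, s). ((`) \<sigma> ` \<beta>, t ((`) \<sigma>) s))"

definition indistinguishability :: "'a set \<Rightarrow> 'a rel \<Rightarrow> 'a rel"
  where "indistinguishability U P =
    {(x, x'). x \<in> U \<and> x' \<in> U \<and>
       {y \<in> U. (y, x) \<in> P} = {y \<in> U. (y, x') \<in> P} \<and>
       {y \<in> U. (x, y) \<in> P} = {y \<in> U. (x', y) \<in> P}}"

definition indist_classes :: "'a set \<Rightarrow> 'a rel \<Rightarrow> 'a set set"
  where "indist_classes U P = U // indistinguishability U P"

definition induced_order :: "'a set set \<Rightarrow> 'a rel \<Rightarrow> 'a set rel"
  where "induced_order \<beta> P =
    {(B, B'). B \<in> \<beta> \<and> B' \<in> \<beta> \<and> (\<exists>x \<in> B. \<exists>y \<in> B'. (x, y) \<in> P)}"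

definition class_decomposition :: "'a set \<Rightarrow> 'a rel \<Rightarrow> 'a set set \<times> 'a set rel"
  where "class_decomposition U P =
    (indist_classes U P, induced_order (indist_classes U P) P)"

end

theory Submission
  imports Defs
begin

text \<open>
  A strict order is an interval order iff \<open>a < b\<close> and \<open>c < d\<close> always imply \<open>a < d\<close> or \<open>c < b\<close>
  (\<open>interval_orders_iff\<close>). This condition says that the strict down-sets form a chain
  under inclusion, and so do the strict up-sets. An automorphism of a finite interval order
  preserves the size of down-sets and up-sets, and in a chain of finite sets the size determines the
  set; hence an automorphism maps each element to an indistinguishable one. Conversely, exchanging
  two indistinguishable elements is an automorphism. Thus a finite interval order is rigid iff no two
  distinct elements are indistinguishable (\<open>rigid_iff_indistinguishability_trivial\<close>).

  The rest is bookkeeping. Whether \<open>x < y\<close> holds depends only on the classes of \<open>x\<close> and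
  \<open>y\<close>, so an order is recovered from its classes and the induced order by replacing each class
  with its elements (\<open>blow_up\<close>). Both passing to classes and blowing up preserve the condition
  above. The induced order has no two distinct indistinguishable elements, and the
  indistinguishability classes of a blow-up of a rigid order are exactly the given blocks; so the two
  constructions are mutually inverse. Naturality holds because all notions are invariant under
  isomorphism.
\<close>

section \<open>Interval orders and indistinguishability\<close>

text \<open>
  If the right-hand condition fails for \<open>a < b\<close> and \<open>c < d\<close>, then irreflexivity and
  transitivity force the four elements to be distinct and exclude every further relation between
  them, so they induce the forbidden subposet. On the right, transitivity is the case \<open>b = c\<close>,
  where irreflexivity excludes the second alternative.
\<close>

lemma interval_orders_iff:
  "P \<in> interval_orders U \<longleftrightarrow>
     P \<subseteq> U \<times> U \<and> irrefl P \<and>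
     (\<forall>a b c d. (a, b) \<in> P \<longrightarrow> (c, d) \<in> P \<longrightarrow> (a, d) \<in> P \<or> (c, b) \<in> P)"
    (is "_ \<longleftrightarrow> ?S \<and> ?I \<and> ?F")
proof
  assume P: "P \<in> interval_orders U"
  then have sub: ?S and irr: ?I and tr: "trans P"
    and free: "\<And>W \<sigma>. W \<subseteq> U \<Longrightarrow> \<not> poset_iso \<sigma> UNIV two_plus_two W (P \<inter> W \<times> W)"
    by (auto simp: interval_orders_def)
  have ?F
  proof (intro allI impI, rule ccontr)
    fix a b c d
    assume ab: "(a, b) \<in> P" and cd: "(c, d) \<in> P" and neg: "\<not> ((a, d) \<in> P \<or> (c, b) \<in> P)"
    have irr': "(x, x) \<notin> P" for x using irr by (auto simp: irrefl_def)
    have tr': "(x, z) \<in> P" if "(x, y) \<in> P" "(y, z) \<in> P" for x y z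
      using tr that by (rule transD)
    have neg': "(a, d) \<notin> P" "(c, b) \<notin> P" using neg by auto
    have distinct: "a \<noteq> b" "c \<noteq> d" "a \<noteq> c" "b \<noteq> d" "a \<noteq> d" "b \<noteq> c"
      using ab cd neg' irr' tr' by metis+
    have unrelated: "(a, c) \<notin> P" "(c, a) \<notin> P" "(b, d) \<notin> P" "(d, b) \<notin> P" "(b, c) \<notin> P"
        "(d, a) \<notin> P" "(b, a) \<notin> P" "(d, c) \<notin> P"
      using ab cd neg' irr' tr' by metis+
    let ?\<sigma> = "\<lambda>(i, j). if i then (if j then b else a) else (if j then d else c)"
    have "inj ?\<sigma>" using distinct by (auto simp: inj_def split: if_splits)
    moreover have "?\<sigma> ` UNIV = {a, b, c, d}"
      unfolding UNIV_Times_UNIV[symmetric] UNIV_bool by auto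
    ultimately have "bij_betw ?\<sigma> UNIV {a, b, c, d}" by (simp add: bij_betw_def)
    then have "poset_iso ?\<sigma> UNIV two_plus_two {a, b, c, d}
        (P \<inter> {a, b, c, d} \<times> {a, b, c, d})"
      using ab cd neg' unrelated irr' by (auto simp: poset_iso_def two_plus_two_def)
    moreover have "{a, b, c, d} \<subseteq> U" using ab cd sub by auto
    ultimately show False using free by blast
  qed
  then show "?S \<and> ?I \<and> ?F" using sub irr by blast
next
  assume R: "?S \<and> ?I \<and> ?F"
  have "trans P"
    using R by (metis irrefl_def transI)
  moreover have "\<not> poset_iso \<sigma> UNIV two_plus_two W (P \<inter> W \<times> W)" for W \<sigma>
  proof
    assume iso: "poset_iso \<sigma> UNIV two_plus_two W (P \<inter> W \<times> W)"
    then have inW: "\<sigma> p \<in> W" for p by (auto simp: poset_iso_def bij_betw_def)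
    have rel: "(\<sigma> p, \<sigma> q) \<in> P \<longleftrightarrow> (p, q) \<in> two_plus_two" for p q
      using iso inW unfolding poset_iso_def by blast
    have "(\<sigma> (True, False), \<sigma> (True, True)) \<in> P" "(\<sigma> (False, False), \<sigma> (False, True)) \<in> P"
      "(\<sigma> (True, False), \<sigma> (False, True)) \<notin> P" "(\<sigma> (False, False), \<sigma> (True, True)) \<notin> P"
      by (auto simp: rel two_plus_two_def)
    with R show False by blast
  qed
  ultimately show "P \<in> interval_orders U" using R by (auto simp: interval_orders_def)
qed

lemma indistinguishability_iff:
  assumes "P \<subseteq> U \<times> U"
  shows "(x, x') \<in> indistinguishability U P \<longleftrightarrow>
    x \<in> U \<and> x' \<in> U \<and> (\<forall>y. ((y, x) \<in> P \<longleftrightarrow> (y, x') \<in> P) \<and> ((x, y) \<in> P \<longleftrightarrow> (x', y) \<in> P))"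
  using assms unfolding indistinguishability_def by blast

lemma equiv_indistinguishability: "equiv U (indistinguishability U P)"
  by (rule equivI) (auto simp: indistinguishability_def refl_on_def sym_def trans_def)

lemma partition_on_indist_classes: "partition_on U (indist_classes U P)"
  unfolding indist_classes_def
  by (rule partition_on_quotient[OF equiv_indistinguishability])

lemma indist_classes_indistinguishable:
  assumes "B \<in> indist_classes U P" and "x \<in> B"
  shows "y \<in> B \<longleftrightarrow> (x, y) \<in> indistinguishability U P"
  using quotient_eq_iff[OF equiv_indistinguishability, of B U P B x y] assms
    in_quotient_imp_closed[OF equiv_indistinguishability, of B U P x y]
  unfolding indist_classes_def by auto

text \<open>
  Membership of a pair in an order is insensitive to replacing either entry by an indistinguishable
  one, so the existential quantifiers in the induced order may be evaluated at any representatives.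
\<close>

lemma induced_order_iff_representatives:
  assumes P: "P \<subseteq> U \<times> U" and B: "B \<in> indist_classes U P" "x \<in> B"
    and B': "B' \<in> indist_classes U P" "y \<in> B'"
  shows "(B, B') \<in> induced_order (indist_classes U P) P \<longleftrightarrow> (x, y) \<in> P"
proof
  assume "(B, B') \<in> induced_order (indist_classes U P) P"
  then obtain x0 y0 where "x0 \<in> B" "y0 \<in> B'" "(x0, y0) \<in> P"
    by (auto simp: induced_order_def)
  moreover from this have "(x0, x) \<in> indistinguishability U P" "(y0, y) \<in> indistinguishability U P"
    using B B' by (auto simp flip: indist_classes_indistinguishable)
  ultimately show "(x, y) \<in> P" by (simp add: indistinguishability_iff[OF P])
next
  assume "(x, y) \<in> P"
  then show "(B, B') \<in> induced_order (indist_classes U P) P"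
    using B B' by (auto simp: induced_order_def)
qed

section \<open>Rigidity\<close>

text \<open>
  Writing \<open>D x\<close> for the strict down-set of \<open>x\<close>, incomparable \<open>D (\<sigma> x)\<close> and
  \<open>D x\<close> would give \<open>a < \<sigma> x\<close> and \<open>c < x\<close> with neither \<open>a < x\<close> nor
  \<open>c < \<sigma> x\<close>. As \<open>\<sigma>\<close> maps \<open>D x\<close> bijectively onto \<open>D (\<sigma> x)\<close>, the two are
  comparable finite sets of equal size, hence equal. The same holds for up-sets.
\<close>

lemma automorphism_indistinguishable:
  assumes fin: "finite U" and P: "P \<in> interval_orders U"
    and iso: "poset_iso \<sigma> U P U P" and x: "x \<in> U"
  shows "(x, \<sigma> x) \<in> indistinguishability U P"
proof -
  have sub: "P \<subseteq> U \<times> U"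
    and ferrers: "\<And>a b c d. (a, b) \<in> P \<Longrightarrow> (c, d) \<in> P \<Longrightarrow> (a, d) \<in> P \<or> (c, b) \<in> P"
    using P unfolding interval_orders_iff by blast+
  have bij: "bij_betw \<sigma> U U"
    and rel: "\<And>y z. y \<in> U \<Longrightarrow> z \<in> U \<Longrightarrow> (\<sigma> y, \<sigma> z) \<in> P \<longleftrightarrow> (y, z) \<in> P"
    using iso by (auto simp: poset_iso_def)
  have inj: "inj_on \<sigma> U" and im: "\<sigma> ` U = U" using bij by (auto simp: bij_betw_def)
  have \<sigma>x: "\<sigma> x \<in> U" using x im by blast
  have eq: "A = B" if "A \<subseteq> B \<or> B \<subseteq> A" "A \<subseteq> U" "B = \<sigma> ` A" for A B
  proof -
    have "card B = card A" using that inj by (simp add: card_image inj_on_subset)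
    moreover have "finite A" "finite B" using that fin finite_subset by auto
    ultimately show ?thesis using that(1) card_subset_eq by metis
  qed
  define D where "D z = {y \<in> U. (y, z) \<in> P}" for z
  define E where "E z = {y \<in> U. (z, y) \<in> P}" for z
  have "D (\<sigma> x) = \<sigma> ` D x"
    unfolding D_def using im rel x by (auto simp: image_iff) (metis imageE)
  moreover have "D x \<subseteq> D (\<sigma> x) \<or> D (\<sigma> x) \<subseteq> D x"
    unfolding D_def using ferrers by blast
  ultimately have "D x = D (\<sigma> x)" using eq[of "D x"] by (auto simp: D_def)
  moreover have "E (\<sigma> x) = \<sigma> ` E x"
    unfolding E_def using im rel x by (auto simp: image_iff) (metis imageE)
  moreover have "E x \<subseteq> E (\<sigma> x) \<or> E (\<sigma> x) \<subseteq> E x"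
    unfolding E_def using ferrers by blast
  ultimately have "D x = D (\<sigma> x)" "E x = E (\<sigma> x)" using eq[of "E x"] by (auto simp: E_def)
  then show ?thesis using x \<sigma>x by (auto simp: indistinguishability_def D_def E_def)
qed

lemma swap_indistinguishable_automorphism:
  assumes P: "P \<subseteq> U \<times> U" and xy: "(x, y) \<in> indistinguishability U P"
  shows "poset_iso (id(x := y, y := x)) U P U P"
proof -
  let ?\<sigma> = "id(x := y, y := x)"
  have "?\<sigma> (?\<sigma> z) = z" for z by auto
  moreover have "?\<sigma> z \<in> U" if "z \<in> U" for z
    using that xy by (auto simp: indistinguishability_def)
  ultimately have "bij_betw ?\<sigma> U U" by (intro bij_betwI[where g = ?\<sigma>]) auto
  moreover have "(u, v) \<in> P \<longleftrightarrow> (?\<sigma> u, ?\<sigma> v) \<in> P" for u v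
    using xy by (auto simp: indistinguishability_iff[OF P])
  ultimately show ?thesis by (simp add: poset_iso_def)
qed

lemma rigid_iff_indistinguishability_trivial:
  assumes "finite U" and P: "P \<in> interval_orders U"
  shows "rigid U P \<longleftrightarrow> indistinguishability U P \<subseteq> Id"
proof
  assume rigid: "rigid U P"
  have sub: "P \<subseteq> U \<times> U" using P by (simp add: interval_orders_iff)
  show "indistinguishability U P \<subseteq> Id"
  proof clarify
    fix x y assume xy: "(x, y) \<in> indistinguishability U P"
    then have "x \<in> U" by (simp add: indistinguishability_def)
    then have "(id(x := y, y := x)) x = x"
      using rigid swap_indistinguishable_automorphism[OF sub xy] unfolding rigid_def by blast
    then show "x = y" by (auto split: if_splits)
  qed
next
  assume "indistinguishability U P \<subseteq> Id"
  then show "rigid U P"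
    using automorphism_indistinguishable[OF assms] unfolding rigid_def by fastforce
qed

lemma rigid_interval_orders_iff:
  assumes "finite U"
  shows "P \<in> rigid_interval_orders U \<longleftrightarrow>
    P \<in> interval_orders U \<and> indistinguishability U P \<subseteq> Id"
  using rigid_iff_indistinguishability_trivial[OF assms]
  by (auto simp: rigid_interval_orders_def)

section \<open>Transport along bijections\<close>

lemma relabel_subset:
  assumes "bij_betw \<sigma> U V" and "P \<subseteq> U \<times> U"
  shows "relabel \<sigma> P \<subseteq> V \<times> V"
  using assms by (auto simp: relabel_def bij_betw_def)

lemma relabel_iff:
  assumes "bij_betw \<sigma> U V" and "P \<subseteq> U \<times> U" and "x \<in> U" and "y \<in> U"
  shows "(\<sigma> x, \<sigma> y) \<in> relabel \<sigma> P \<longleftrightarrow> (x, y) \<in> P"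
proof
  assume "(\<sigma> x, \<sigma> y) \<in> relabel \<sigma> P"
  then obtain x' y' where xy': "(x', y') \<in> P" "\<sigma> x = \<sigma> x'" "\<sigma> y = \<sigma> y'"
    by (auto simp: relabel_def)
  moreover from this have "x' \<in> U" "y' \<in> U" using assms(2) by auto
  ultimately have "x' = x" "y' = y" using assms by (auto simp: bij_betw_def dest: inj_onD)
  with xy' show "(x, y) \<in> P" by simp
qed (force simp: relabel_def)

lemma relabel_interval_orders:
  assumes \<sigma>: "bij_betw \<sigma> U V" and P: "P \<in> interval_orders U"
  shows "relabel \<sigma> P \<in> interval_orders V"
proof -
  have sub: "P \<subseteq> U \<times> U" and irr: "irrefl P"
    and ferrers: "\<And>a b c d. (a, b) \<in> P \<Longrightarrow> (c, d) \<in> P \<Longrightarrow> (a, d) \<in> P \<or> (c, b) \<in> P"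
    using P unfolding interval_orders_iff by blast+
  have V: "v \<in> V \<longleftrightarrow> (\<exists>u\<in>U. v = \<sigma> u)" for v using \<sigma> by (auto simp: bij_betw_def)
  note sub' = relabel_subset[OF \<sigma> sub]
  have "irrefl (relabel \<sigma> P)"
    unfolding irrefl_def
  proof (intro allI notI)
    fix v assume v: "(v, v) \<in> relabel \<sigma> P"
    then obtain u where "u \<in> U" "v = \<sigma> u" using sub' V by blast
    then show False using v irr relabel_iff[OF \<sigma> sub] by (auto simp: irrefl_def)
  qed
  moreover have "(a, d) \<in> relabel \<sigma> P \<or> (c, b) \<in> relabel \<sigma> P"
    if "(a, b) \<in> relabel \<sigma> P" "(c, d) \<in> relabel \<sigma> P" for a b c d
  proof -
    have "a \<in> V" "b \<in> V" "c \<in> V" "d \<in> V" using that sub' by auto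
    then obtain a' b' c' d' where "a' \<in> U" "b' \<in> U" "c' \<in> U" "d' \<in> U"
      "a = \<sigma> a'" "b = \<sigma> b'" "c = \<sigma> c'" "d = \<sigma> d'" using V by auto
    then show ?thesis using that ferrers[of a' b' c' d'] relabel_iff[OF \<sigma> sub] by auto
  qed
  ultimately show ?thesis using sub' by (auto simp: interval_orders_iff)
qed

lemma relabel_indistinguishability:
  assumes \<sigma>: "bij_betw \<sigma> U V" and P: "P \<subseteq> U \<times> U"
  shows "indistinguishability V (relabel \<sigma> P) = relabel \<sigma> (indistinguishability U P)"
proof -
  have V: "V = \<sigma> ` U" using \<sigma> by (auto simp: bij_betw_def)
  have iff: "(\<sigma> x, \<sigma> x') \<in> indistinguishability V (relabel \<sigma> P) \<longleftrightarrow>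
      (x, x') \<in> indistinguishability U P" if "x \<in> U" "x' \<in> U" for x x'
  proof -
    have "(\<sigma> x, \<sigma> x') \<in> indistinguishability V (relabel \<sigma> P) \<longleftrightarrow>
      (\<forall>v\<in>V. ((v, \<sigma> x) \<in> relabel \<sigma> P \<longleftrightarrow> (v, \<sigma> x') \<in> relabel \<sigma> P) \<and>
              ((\<sigma> x, v) \<in> relabel \<sigma> P \<longleftrightarrow> (\<sigma> x', v) \<in> relabel \<sigma> P))"
      using that V unfolding indistinguishability_def by blast
    also have "\<dots> \<longleftrightarrow> (\<forall>y\<in>U. ((y, x) \<in> P \<longleftrightarrow> (y, x') \<in> P) \<and> ((x, y) \<in> P \<longleftrightarrow> (x', y) \<in> P))"
      using that relabel_iff[OF \<sigma> P] by (simp add: V)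
    also have "\<dots> \<longleftrightarrow> (x, x') \<in> indistinguishability U P"
      using that unfolding indistinguishability_def by blast
    finally show ?thesis .
  qed
  show ?thesis
  proof (intro equalityI subrelI)
    fix v v' assume vv': "(v, v') \<in> indistinguishability V (relabel \<sigma> P)"
    then obtain x x' where x: "x \<in> U" "x' \<in> U" "v = \<sigma> x" "v' = \<sigma> x'"
      by (auto simp: indistinguishability_def V)
    then show "(v, v') \<in> relabel \<sigma> (indistinguishability U P)"
      using vv' iff by (force simp: relabel_def)
  next
    fix v v' assume "(v, v') \<in> relabel \<sigma> (indistinguishability U P)"
    then obtain x x' where x: "(x, x') \<in> indistinguishability U P" "v = \<sigma> x" "v' = \<sigma> x'"
      by (auto simp: relabel_def)
    then have "x \<in> U" "x' \<in> U" by (auto simp: indistinguishability_def)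
    with x iff show "(v, v') \<in> indistinguishability V (relabel \<sigma> P)" by auto
  qed
qed

lemma relabel_rigid_interval_orders:
  assumes "finite U" and "finite V" and \<sigma>: "bij_betw \<sigma> U V" and P: "P \<in> rigid_interval_orders U"
  shows "relabel \<sigma> P \<in> rigid_interval_orders V"
proof -
  have "P \<in> interval_orders U" and triv: "indistinguishability U P \<subseteq> Id"
    using P rigid_interval_orders_iff[OF assms(1)] by auto
  moreover from this have "P \<subseteq> U \<times> U" by (simp add: interval_orders_iff)
  moreover have "relabel \<sigma> (indistinguishability U P) \<subseteq> Id"
    using triv by (auto simp: relabel_def)
  ultimately show ?thesis
    using relabel_interval_orders[OF \<sigma>] relabel_indistinguishability[OF \<sigma>]
    by (simp add: rigid_interval_orders_iff[OF assms(2)])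
qed

lemma relabel_cong:
  assumes "P \<subseteq> U \<times> U" and "\<forall>x\<in>U. \<sigma> x = \<tau> x"
  shows "relabel \<sigma> P = relabel \<tau> P"
  unfolding relabel_def using assms by (intro image_cong) auto

lemma relabel_id: "relabel id P = P"
  by (simp add: relabel_def map_prod.id)

lemma relabel_comp: "relabel (\<tau> \<circ> \<sigma>) P = relabel \<tau> (relabel \<sigma> P)"
  by (simp add: relabel_def image_image case_prod_beta map_prod_def)

lemma species_relations:
  fixes F1 :: "'a set \<Rightarrow> 'a rel set" and F2 :: "'b set \<Rightarrow> 'b rel set"
  assumes sub: "\<And>U. F1 U \<subseteq> Pow (U \<times> U)"
    and transport: "\<And>U V \<sigma> P. finite U \<Longrightarrow> finite V \<Longrightarrow> bij_betw \<sigma> U V \<Longrightarrow> P \<in> F1 U \<Longrightarrow>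
      relabel \<sigma> P \<in> F2 V"
  shows "species F1 F2 F3 relabel relabel relabel relabel"
  unfolding species_def
proof (intro conjI allI impI ballI)
  fix U :: "'a set" assume "finite U"
  then show "finite (F1 U)" using finite_subset[OF sub] by simp
next
  fix U :: "'a set" and V :: "'b set" and \<sigma> \<tau> P
  assume "finite U \<and> finite V \<and> bij_betw \<sigma> U V \<and> (\<forall>x\<in>U. \<sigma> x = \<tau> x)" and "P \<in> F1 U"
  then show "relabel \<sigma> P = relabel \<tau> P" using sub by (intro relabel_cong[of P U]) auto
next
  fix U :: "'a set" and V :: "'b set" and \<sigma> P
  assume "finite U \<and> finite V \<and> bij_betw \<sigma> U V" and "P \<in> F1 U"
  then show "relabel \<sigma> P \<in> F2 V" by (intro transport[of U V \<sigma> P]) auto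
qed (simp_all add: relabel_id relabel_comp)

lemma partition_on_image:
  assumes \<sigma>: "bij_betw \<sigma> U V" and \<beta>: "partition_on U \<beta>"
  shows "partition_on V ((`) \<sigma> ` \<beta>)"
proof -
  have inj: "inj_on \<sigma> U" and V: "V = \<sigma> ` U" using \<sigma> by (auto simp: bij_betw_def)
  show ?thesis unfolding V
  proof (rule partition_onI)
    fix p q assume "p \<in> (`) \<sigma> ` \<beta>" "q \<in> (`) \<sigma> ` \<beta>" "p \<noteq> q"
    then obtain B C where BC: "B \<in> \<beta>" "C \<in> \<beta>" "p = \<sigma> ` B" "q = \<sigma> ` C" "B \<noteq> C" by auto
    then have "B \<inter> C = {}" "B \<subseteq> U" "C \<subseteq> U"
      using partition_onD1[OF \<beta>] partition_onD2[OF \<beta>] by (auto simp: disjoint_def)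
    then show "disjnt p q"
      using BC inj_on_image_Int[OF inj, of B C] by (auto simp: disjnt_def)
  qed (use partition_onD1[OF \<beta>] partition_onD3[OF \<beta>] in auto)
qed

lemma bij_betw_image_partition:
  assumes \<sigma>: "bij_betw \<sigma> U V" and \<beta>: "partition_on U \<beta>"
  shows "bij_betw ((`) \<sigma>) \<beta> ((`) \<sigma> ` \<beta>)"
proof (rule inj_on_imp_bij_betw)
  have "\<beta> \<subseteq> Pow U" using partition_onD1[OF \<beta>] by auto
  then show "inj_on ((`) \<sigma>) \<beta>"
    using \<sigma> inj_on_image_Pow inj_on_subset unfolding bij_betw_def by metis
qed

text \<open>
  A bijection \<open>\<sigma>\<close> acts on blocks by direct image, which is a bijection between the sets of
  blocks and is functorial in \<open>\<sigma>\<close>. So each law for the composite is the corresponding law of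
  \<open>F\<close> on sets of blocks; finiteness uses that a finite set has finitely many partitions.
\<close>

lemma species_comp_E_plus:
  fixes F1 :: "'a set set \<Rightarrow> 'r set" and F2 :: "'b set set \<Rightarrow> 's set" and F3 :: "'c set set \<Rightarrow> 't set"
  assumes F: "species F1 F2 F3 t11 t12 t23 t13"
  shows "species (comp_E_plus F1) (comp_E_plus F2) (comp_E_plus F3)
    (comp_E_plus_transport t11) (comp_E_plus_transport t12)
    (comp_E_plus_transport t23) (comp_E_plus_transport t13)"
proof -
  have F_finite: "finite (F1 U)" if "finite U" for U
    using F that unfolding species_def by meson
  have F_transport: "t12 \<sigma> s \<in> F2 V"
    if "finite U" "finite V" "bij_betw \<sigma> U V" "s \<in> F1 U" for U V \<sigma> s
    using F that unfolding species_def by meson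
  have F_cong: "t12 \<sigma> s = t12 \<tau> s"
    if "finite U" "finite V" "bij_betw \<sigma> U V" "\<forall>x\<in>U. \<sigma> x = \<tau> x" "s \<in> F1 U" for U V \<sigma> \<tau> s
    using F that unfolding species_def by meson
  have F_id: "t11 id s = s" if "finite U" "s \<in> F1 U" for U s
    using F that unfolding species_def by meson
  have F_comp: "t13 (\<tau> \<circ> \<sigma>) s = t23 \<tau> (t12 \<sigma> s)"
    if "finite U" "finite V" "finite W" "bij_betw \<sigma> U V" "bij_betw \<tau> V W" "s \<in> F1 U"
    for U V W \<sigma> \<tau> s
    using F that unfolding species_def by meson
  have fin: "finite \<beta>" if "finite U" "partition_on U \<beta>" for U and \<beta> :: "'x set set"
    using finite_elements that by blast
  show ?thesis
    unfolding species_def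
  proof (intro conjI allI impI ballI)
    fix U :: "'a set" assume U: "finite U"
    have "comp_E_plus F1 U = Sigma {\<beta>. partition_on U \<beta>} F1"
      by (auto simp: comp_E_plus_def)
    moreover have "finite {\<beta>. partition_on U \<beta>}"
      using finitely_many_partition_on[OF U] .
    ultimately show "finite (comp_E_plus F1 U)"
      using F_finite fin[OF U] by auto
  next
    fix U :: "'a set" and V :: "'b set" and \<sigma> s
    assume A: "finite U \<and> finite V \<and> bij_betw \<sigma> U V" and s: "s \<in> comp_E_plus F1 U"
    then obtain \<beta> r where r: "s = (\<beta>, r)" "partition_on U \<beta>" "r \<in> F1 \<beta>"
      by (auto simp: comp_E_plus_def)
    moreover have "finite \<beta>" using fin A r by blast
    ultimately have "t12 ((`) \<sigma>) r \<in> F2 ((`) \<sigma> ` \<beta>)"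
      using F_transport[OF _ _ bij_betw_image_partition[of \<sigma> U V \<beta>]] A r by simp
    then show "comp_E_plus_transport t12 \<sigma> s \<in> comp_E_plus F2 V"
      using r A partition_on_image[of \<sigma> U V \<beta>]
      by (auto simp: comp_E_plus_def comp_E_plus_transport_def)
  next
    fix U :: "'a set" and V :: "'b set" and \<sigma> \<tau> s
    assume A: "finite U \<and> finite V \<and> bij_betw \<sigma> U V \<and> (\<forall>x\<in>U. \<sigma> x = \<tau> x)"
      and s: "s \<in> comp_E_plus F1 U"
    then obtain \<beta> r where r: "s = (\<beta>, r)" "partition_on U \<beta>" "r \<in> F1 \<beta>"
      by (auto simp: comp_E_plus_def)
    have eq: "\<forall>B\<in>\<beta>. \<sigma> ` B = \<tau> ` B"
      using A partition_onD1[OF r(2)] by (intro ballI image_cong) auto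
    moreover have "finite \<beta>" using fin A r by blast
    ultimately have "t12 ((`) \<sigma>) r = t12 ((`) \<tau>) r"
      using F_cong[OF _ _ bij_betw_image_partition[of \<sigma> U V \<beta>]] A r by simp
    moreover have "(`) \<sigma> ` \<beta> = (`) \<tau> ` \<beta>" by (rule image_cong[OF refl]) (use eq in blast)
    ultimately show "comp_E_plus_transport t12 \<sigma> s = comp_E_plus_transport t12 \<tau> s"
      by (simp add: r(1) comp_E_plus_transport_def)
  next
    fix U :: "'a set" and s
    assume U: "finite U" and "s \<in> comp_E_plus F1 U"
    then obtain \<beta> r where r: "s = (\<beta>, r)" "partition_on U \<beta>" "r \<in> F1 \<beta>"
      by (auto simp: comp_E_plus_def)
    have "(`) id = (id :: 'a set \<Rightarrow> 'a set)" by auto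
    moreover have "t11 id r = r" using F_id[OF fin[OF U r(2)] r(3)] .
    ultimately show "comp_E_plus_transport t11 id s = s"
      by (simp add: r(1) comp_E_plus_transport_def)
  next
    fix U :: "'a set" and V :: "'b set" and W :: "'c set" and \<sigma> \<tau> s
    assume A: "finite U \<and> finite V \<and> finite W \<and> bij_betw \<sigma> U V \<and> bij_betw \<tau> V W"
      and "s \<in> comp_E_plus F1 U"
    then obtain \<beta> r where r: "s = (\<beta>, r)" "partition_on U \<beta>" "r \<in> F1 \<beta>"
      by (auto simp: comp_E_plus_def)
    have part: "partition_on V ((`) \<sigma> ` \<beta>)" using partition_on_image A r(2) by blast
    have bij: "bij_betw ((`) \<sigma>) \<beta> ((`) \<sigma> ` \<beta>)"
      "bij_betw ((`) \<tau>) ((`) \<sigma> ` \<beta>) ((`) \<tau> ` (`) \<sigma> ` \<beta>)"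
      using bij_betw_image_partition A r(2) part by blast+
    have "finite \<beta>" using fin A r by blast
    then have "t13 ((`) \<tau> \<circ> (`) \<sigma>) r = t23 ((`) \<tau>) (t12 ((`) \<sigma>) r)"
      using F_comp[OF _ _ _ bij r(3)] by simp
    moreover have "(`) (\<tau> \<circ> \<sigma>) = (`) \<tau> \<circ> (`) \<sigma>" by (auto simp: image_comp)
    ultimately show "comp_E_plus_transport t13 (\<tau> \<circ> \<sigma>) s =
        comp_E_plus_transport t23 \<tau> (comp_E_plus_transport t12 \<sigma> s)"
      by (simp add: r(1) comp_E_plus_transport_def image_comp)
  qed
qed

section \<open>Class decomposition and its inverse\<close>

definition blow_up :: "'a set set \<Rightarrow> 'a set rel \<Rightarrow> 'a rel"
  where "blow_up \<beta> Q = {(x, y). \<exists>B \<in> \<beta>. \<exists>B' \<in> \<beta>. x \<in> B \<and> y \<in> B' \<and> (B, B') \<in> Q}"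

lemma blow_up_iff:
  assumes "partition_on U \<beta>" and "B \<in> \<beta>" and "B' \<in> \<beta>" and "x \<in> B" and "y \<in> B'"
  shows "(x, y) \<in> blow_up \<beta> Q \<longleftrightarrow> (B, B') \<in> Q"
proof -
  have "C = B" if "C \<in> \<beta>" "x \<in> C" for C
    using assms that partition_onD2 disjointD by blast
  moreover have "C = B'" if "C \<in> \<beta>" "y \<in> C" for C
    using assms that partition_onD2 disjointD by blast
  ultimately show ?thesis using assms(2-) unfolding blow_up_def by blast
qed

lemma blow_up_subset:
  assumes "partition_on U \<beta>"
  shows "blow_up \<beta> Q \<subseteq> U \<times> U"
  using partition_onD1[OF assms] by (auto simp: blow_up_def)

lemma blow_up_interval_orders:
  assumes \<beta>: "partition_on U \<beta>" and Q: "Q \<in> interval_orders \<beta>"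
  shows "blow_up \<beta> Q \<in> interval_orders U"
proof -
  have irr: "irrefl Q"
    and ferrers: "\<And>a b c d. (a, b) \<in> Q \<Longrightarrow> (c, d) \<in> Q \<Longrightarrow> (a, d) \<in> Q \<or> (c, b) \<in> Q"
    using Q unfolding interval_orders_iff by blast+
  have block: "\<exists>B\<in>\<beta>. x \<in> B" if "x \<in> U" for x using that partition_onD1[OF \<beta>] by auto
  note sub = blow_up_subset[OF \<beta>, of Q]
  have "irrefl (blow_up \<beta> Q)"
    unfolding irrefl_def
  proof (intro allI notI)
    fix x assume x: "(x, x) \<in> blow_up \<beta> Q"
    then obtain B where B: "B \<in> \<beta>" "x \<in> B" using sub block by blast
    with x have "(B, B) \<in> Q" using blow_up_iff[OF \<beta> B(1) B(1) B(2) B(2)] by blast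
    then show False using irr by (auto simp: irrefl_def)
  qed
  moreover have "(a, d) \<in> blow_up \<beta> Q \<or> (c, b) \<in> blow_up \<beta> Q"
    if ab: "(a, b) \<in> blow_up \<beta> Q" and cd: "(c, d) \<in> blow_up \<beta> Q" for a b c d
  proof -
    obtain A B where "A \<in> \<beta>" "B \<in> \<beta>" "a \<in> A" "b \<in> B" "(A, B) \<in> Q"
      using ab by (auto simp: blow_up_def)
    moreover obtain C D where "C \<in> \<beta>" "D \<in> \<beta>" "c \<in> C" "d \<in> D" "(C, D) \<in> Q"
      using cd by (auto simp: blow_up_def)
    ultimately show ?thesis using ferrers[of A B C D] by (auto simp: blow_up_def)
  qed
  ultimately show ?thesis using sub by (auto simp: interval_orders_iff)
qed

lemma blow_up_induced_order:
  assumes P: "P \<subseteq> U \<times> U"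
  shows "blow_up (indist_classes U P) (induced_order (indist_classes U P) P) = P"
proof -
  let ?\<beta> = "indist_classes U P"
  have "(x, y) \<in> blow_up ?\<beta> (induced_order ?\<beta> P)" if "(x, y) \<in> P" for x y
  proof -
    have "x \<in> \<Union>?\<beta>" "y \<in> \<Union>?\<beta>"
      using that P partition_onD1[OF partition_on_indist_classes, of U P] by auto
    then show ?thesis using that by (auto simp: blow_up_def induced_order_def)
  qed
  moreover have "(x, y) \<in> P" if "(x, y) \<in> blow_up ?\<beta> (induced_order ?\<beta> P)" for x y
    using that induced_order_iff_representatives[OF P] by (auto simp: blow_up_def)
  ultimately show ?thesis by auto
qed

text \<open>
  Every condition on the induced order is checked on representatives, where it becomes the
  corresponding condition on \<open>P\<close>. In particular, if two classes are indistinguishable in the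
  induced order, then their representatives are indistinguishable in \<open>P\<close>, so the classes
  coincide.
\<close>

lemma induced_order_rigid_interval_orders:
  assumes fin: "finite U" and P: "P \<in> interval_orders U"
  shows "induced_order (indist_classes U P) P \<in> rigid_interval_orders (indist_classes U P)"
proof -
  let ?\<beta> = "indist_classes U P"
  let ?Q = "induced_order ?\<beta> P"
  have sub: "P \<subseteq> U \<times> U" and irr: "irrefl P"
    and ferrers: "\<And>a b c d. (a, b) \<in> P \<Longrightarrow> (c, d) \<in> P \<Longrightarrow> (a, d) \<in> P \<or> (c, b) \<in> P"
    using P unfolding interval_orders_iff by blast+
  note part = partition_on_indist_classes[of U P]
  note reps = induced_order_iff_representatives[OF sub]
  have subQ: "?Q \<subseteq> ?\<beta> \<times> ?\<beta>" by (auto simp: induced_order_def)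
  have nonempty: "\<exists>x. x \<in> B" if "B \<in> ?\<beta>" for B
    using that partition_onD3[OF part] by (metis ex_in_conv)
  have "irrefl ?Q"
    unfolding irrefl_def
  proof (intro allI notI)
    fix B assume B: "(B, B) \<in> ?Q"
    then obtain x where "B \<in> ?\<beta>" "x \<in> B" using subQ nonempty by blast
    with B irr show False using reps unfolding irrefl_def by blast
  qed
  moreover have "(A, D) \<in> ?Q \<or> (C, B) \<in> ?Q" if AB: "(A, B) \<in> ?Q" and CD: "(C, D) \<in> ?Q" for A B C D
  proof -
    obtain a b where "A \<in> ?\<beta>" "B \<in> ?\<beta>" "a \<in> A" "b \<in> B" "(a, b) \<in> P"
      using AB by (auto simp: induced_order_def)
    moreover obtain c d where "C \<in> ?\<beta>" "D \<in> ?\<beta>" "c \<in> C" "d \<in> D" "(c, d) \<in> P"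
      using CD by (auto simp: induced_order_def)
    ultimately show ?thesis using ferrers[of a b c d] by (auto simp: induced_order_def)
  qed
  ultimately have "?Q \<in> interval_orders ?\<beta>" using subQ by (auto simp: interval_orders_iff)
  moreover have "indistinguishability ?\<beta> ?Q \<subseteq> Id"
  proof clarify
    fix B B' assume BB': "(B, B') \<in> indistinguishability ?\<beta> ?Q"
    then have B: "B \<in> ?\<beta>" "B' \<in> ?\<beta>" by (auto simp: indistinguishability_def)
    then obtain x x' where x: "x \<in> B" "x' \<in> B'" using nonempty by blast
    have "((y, x) \<in> P \<longleftrightarrow> (y, x') \<in> P) \<and> ((x, y) \<in> P \<longleftrightarrow> (x', y) \<in> P)" if y: "y \<in> U" for y
    proof -
      obtain C where C: "C \<in> ?\<beta>" "y \<in> C" using y partition_onD1[OF part] by blast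
      have "((C, B) \<in> ?Q \<longleftrightarrow> (C, B') \<in> ?Q) \<and> ((B, C) \<in> ?Q \<longleftrightarrow> (B', C) \<in> ?Q)"
        using BB' by (simp add: indistinguishability_iff[OF subQ])
      then show ?thesis using reps B x C by simp
    qed
    moreover have "x \<in> U" "x' \<in> U" using B x partition_onD1[OF part] by auto
    ultimately have "(x, x') \<in> indistinguishability U P"
      unfolding indistinguishability_def by blast
    then have "x' \<in> B" using indist_classes_indistinguishable B x by metis
    then show "B = B'" using B x partition_onD2[OF part] by (auto simp: disjoint_def)
  qed
  moreover have "finite ?\<beta>" using finite_elements[OF fin part] .
  ultimately show ?thesis by (simp add: rigid_interval_orders_iff)
qed

text \<open>
  Elements of a common block are indistinguishable in a blow-up by construction. Elements of different
  blocks are not, because their blocks are distinguished by some block, hence by any element of it.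
\<close>

lemma indistinguishability_blow_up:
  assumes \<beta>: "partition_on U \<beta>" and Q: "Q \<subseteq> \<beta> \<times> \<beta>" and triv: "indistinguishability \<beta> Q \<subseteq> Id"
    and B: "B \<in> \<beta>" "x \<in> B"
  shows "(x, y) \<in> indistinguishability U (blow_up \<beta> Q) \<longleftrightarrow> y \<in> B"
proof
  assume xy: "(x, y) \<in> indistinguishability U (blow_up \<beta> Q)"
  then have "y \<in> U" by (simp add: indistinguishability_def)
  then obtain B' where B': "B' \<in> \<beta>" "y \<in> B'" using partition_onD1[OF \<beta>] by auto
  have "((C, B) \<in> Q \<longleftrightarrow> (C, B') \<in> Q) \<and> ((B, C) \<in> Q \<longleftrightarrow> (B', C) \<in> Q)" if C: "C \<in> \<beta>" for C
  proof -
    obtain z where z: "z \<in> C" using C partition_onD3[OF \<beta>] by (metis ex_in_conv)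
    have "((z, x) \<in> blow_up \<beta> Q \<longleftrightarrow> (z, y) \<in> blow_up \<beta> Q) \<and>
        ((x, z) \<in> blow_up \<beta> Q \<longleftrightarrow> (y, z) \<in> blow_up \<beta> Q)"
      using xy by (simp add: indistinguishability_iff[OF blow_up_subset[OF \<beta>]])
    then show ?thesis using blow_up_iff[OF \<beta>] B B' C z by simp
  qed
  then have "(B, B') \<in> indistinguishability \<beta> Q"
    using B B' unfolding indistinguishability_def by blast
  then show "y \<in> B" using triv B' by auto
next
  assume y: "y \<in> B"
  have "((z, x) \<in> blow_up \<beta> Q \<longleftrightarrow> (z, y) \<in> blow_up \<beta> Q) \<and>
      ((x, z) \<in> blow_up \<beta> Q \<longleftrightarrow> (y, z) \<in> blow_up \<beta> Q)" if z: "z \<in> U" for z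
  proof -
    obtain C where "C \<in> \<beta>" "z \<in> C" using z partition_onD1[OF \<beta>] by blast
    then show ?thesis using blow_up_iff[OF \<beta>] B y by simp
  qed
  moreover have "x \<in> U" "y \<in> U" using B y partition_onD1[OF \<beta>] by auto
  ultimately show "(x, y) \<in> indistinguishability U (blow_up \<beta> Q)"
    unfolding indistinguishability_def by blast
qed

lemma indist_classes_blow_up:
  assumes \<beta>: "partition_on U \<beta>" and Q: "Q \<subseteq> \<beta> \<times> \<beta>" and triv: "indistinguishability \<beta> Q \<subseteq> Id"
  shows "indist_classes U (blow_up \<beta> Q) = \<beta>"
proof -
  let ?r = "indistinguishability U (blow_up \<beta> Q)"
  have class_eq: "?r `` {x} = B" if "B \<in> \<beta>" "x \<in> B" for B x
    using indistinguishability_blow_up[OF \<beta> Q triv that] by auto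
  have "\<exists>B\<in>\<beta>. x \<in> B" if "x \<in> U" for x
    using that partition_onD1[OF \<beta>] by auto
  then have "U // ?r \<subseteq> \<beta>" using class_eq by (fastforce simp: quotient_def)
  moreover have "B \<in> U // ?r" if B: "B \<in> \<beta>" for B
  proof -
    obtain x where x: "x \<in> B" using B partition_onD3[OF \<beta>] by (metis ex_in_conv)
    then have "x \<in> U" using B partition_onD1[OF \<beta>] by auto
    then show ?thesis using quotientI[of x U ?r] class_eq[OF B x] by simp
  qed
  ultimately show ?thesis by (auto simp: indist_classes_def)
qed

lemma induced_order_blow_up:
  assumes \<beta>: "partition_on U \<beta>" and Q: "Q \<subseteq> \<beta> \<times> \<beta>"
  shows "induced_order \<beta> (blow_up \<beta> Q) = Q"
proof -
  have "(B, B') \<in> induced_order \<beta> (blow_up \<beta> Q) \<longleftrightarrow> (B, B') \<in> Q" if B: "B \<in> \<beta>" "B' \<in> \<beta>" for B B'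
  proof -
    have "\<exists>x. x \<in> B" "\<exists>y. y \<in> B'" using B partition_onD3[OF \<beta>] by (metis ex_in_conv)+
    then show ?thesis
      using blow_up_iff[OF \<beta> B, of _ _ Q] B unfolding induced_order_def by blast
  qed
  moreover have "induced_order \<beta> (blow_up \<beta> Q) \<subseteq> \<beta> \<times> \<beta>" by (auto simp: induced_order_def)
  ultimately show ?thesis using Q by auto
qed

lemma bij_betw_class_decomposition:
  assumes fin: "finite U"
  shows "bij_betw (class_decomposition U) (interval_orders U) (comp_E_plus rigid_interval_orders U)"
proof (rule bij_betwI[where g = "\<lambda>(\<beta>, Q). blow_up \<beta> Q"])
  show "class_decomposition U \<in> interval_orders U \<rightarrow> comp_E_plus rigid_interval_orders U"
    using induced_order_rigid_interval_orders[OF fin]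
    by (auto simp: class_decomposition_def comp_E_plus_def partition_on_indist_classes)
  show "(\<lambda>(\<beta>, Q). blow_up \<beta> Q) \<in> comp_E_plus rigid_interval_orders U \<rightarrow> interval_orders U"
    by (auto simp: comp_E_plus_def rigid_interval_orders_def blow_up_interval_orders)
next
  fix P assume "P \<in> interval_orders U"
  then show "(\<lambda>(\<beta>, Q). blow_up \<beta> Q) (class_decomposition U P) = P"
    by (simp add: class_decomposition_def blow_up_induced_order interval_orders_iff)
next
  fix s assume "s \<in> comp_E_plus rigid_interval_orders U"
  then obtain \<beta> Q where s: "s = (\<beta>, Q)" and \<beta>: "partition_on U \<beta>"
    and Q: "Q \<in> rigid_interval_orders \<beta>"
    by (auto simp: comp_E_plus_def)
  have "Q \<subseteq> \<beta> \<times> \<beta>" "indistinguishability \<beta> Q \<subseteq> Id"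
    using Q rigid_interval_orders_iff[OF finite_elements[OF fin \<beta>]]
    by (auto simp: interval_orders_iff)
  then show "class_decomposition U ((\<lambda>(\<beta>, Q). blow_up \<beta> Q) s) = s"
    by (simp add: s class_decomposition_def indist_classes_blow_up[OF \<beta>]
        induced_order_blow_up[OF \<beta>])
qed

section \<open>Naturality\<close>

lemma indist_classes_relabel:
  assumes \<sigma>: "bij_betw \<sigma> U V" and P: "P \<subseteq> U \<times> U"
  shows "indist_classes V (relabel \<sigma> P) = (`) \<sigma> ` indist_classes U P"
proof -
  have V: "V = \<sigma> ` U" using \<sigma> by (simp add: bij_betw_def)
  have sub: "indistinguishability U P \<subseteq> U \<times> U" by (auto simp: indistinguishability_def)
  have "relabel \<sigma> (indistinguishability U P) `` {\<sigma> x} = \<sigma> ` (indistinguishability U P `` {x})"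
    if "x \<in> U" for x
  proof (intro equalityI subsetI)
    fix v assume v: "v \<in> relabel \<sigma> (indistinguishability U P) `` {\<sigma> x}"
    then have "v \<in> V" using relabel_subset[OF \<sigma> sub] by blast
    then obtain y where "y \<in> U" "v = \<sigma> y" using V by blast
    then show "v \<in> \<sigma> ` (indistinguishability U P `` {x})"
      using v relabel_iff[OF \<sigma> sub \<open>x \<in> U\<close>] by blast
  next
    fix v assume "v \<in> \<sigma> ` (indistinguishability U P `` {x})"
    then show "v \<in> relabel \<sigma> (indistinguishability U P) `` {\<sigma> x}"
      by (force simp: relabel_def)
  qed
  then show ?thesis
    unfolding indist_classes_def relabel_indistinguishability[OF \<sigma> P]
    unfolding quotient_def V by (simp add: UNION_singleton_eq_range image_image)
qed

lemma induced_order_relabel: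
  assumes \<sigma>: "bij_betw \<sigma> U V" and P: "P \<subseteq> U \<times> U" and \<beta>: "\<Union>\<beta> \<subseteq> U"
  shows "induced_order ((`) \<sigma> ` \<beta>) (relabel \<sigma> P) = relabel ((`) \<sigma>) (induced_order \<beta> P)"
proof -
  have iff: "(\<exists>v\<in>\<sigma> ` B. \<exists>w\<in>\<sigma> ` B'. (v, w) \<in> relabel \<sigma> P) \<longleftrightarrow> (\<exists>x\<in>B. \<exists>y\<in>B'. (x, y) \<in> P)"
    if "B \<in> \<beta>" "B' \<in> \<beta>" for B B'
  proof -
    have "(\<sigma> x, \<sigma> y) \<in> relabel \<sigma> P \<longleftrightarrow> (x, y) \<in> P" if "x \<in> B" "y \<in> B'" for x y
      using relabel_iff[OF \<sigma> P] that \<open>B \<in> \<beta>\<close> \<open>B' \<in> \<beta>\<close> \<beta> by blast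
    then show ?thesis by auto
  qed
  show ?thesis
  proof (intro equalityI subrelI)
    fix C C' assume CC': "(C, C') \<in> induced_order ((`) \<sigma> ` \<beta>) (relabel \<sigma> P)"
    then obtain B B' where B: "B \<in> \<beta>" "B' \<in> \<beta>" "C = \<sigma> ` B" "C' = \<sigma> ` B'"
      unfolding induced_order_def by blast
    then have "(B, B') \<in> induced_order \<beta> P"
      using CC' iff unfolding induced_order_def by blast
    then show "(C, C') \<in> relabel ((`) \<sigma>) (induced_order \<beta> P)"
      unfolding relabel_def B(3,4) by (rule map_prod_imageI)
  next
    fix C C' assume "(C, C') \<in> relabel ((`) \<sigma>) (induced_order \<beta> P)"
    then obtain B B' where "C = \<sigma> ` B" "C' = \<sigma> ` B'" "(B, B') \<in> induced_order \<beta> P"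
      by (auto simp: relabel_def)
    then show "(C, C') \<in> induced_order ((`) \<sigma> ` \<beta>) (relabel \<sigma> P)"
      using iff unfolding induced_order_def by blast
  qed
qed

lemma class_decomposition_relabel:
  assumes \<sigma>: "bij_betw \<sigma> U V" and P: "P \<subseteq> U \<times> U"
  shows "class_decomposition V (relabel \<sigma> P) =
    comp_E_plus_transport relabel \<sigma> (class_decomposition U P)"
proof -
  have "\<Union>(indist_classes U P) \<subseteq> U"
    using partition_onD1[OF partition_on_indist_classes, of U P] by simp
  then show ?thesis
    by (simp add: class_decomposition_def comp_E_plus_transport_def
        indist_classes_relabel[OF assms] induced_order_relabel[OF assms])
qed

theorem theorem8p2:
  shows
    "species
       (interval_orders :: 'a set \<Rightarrow> 'a rel set)
       (interval_orders :: 'b set \<Rightarrow> 'b rel set)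
       (interval_orders :: 'c set \<Rightarrow> 'c rel set)
       relabel relabel relabel relabel \<and>
     species
       (rigid_interval_orders :: 'a set \<Rightarrow> 'a rel set)
       (rigid_interval_orders :: 'b set \<Rightarrow> 'b rel set)
       (rigid_interval_orders :: 'c set \<Rightarrow> 'c rel set)
       relabel relabel relabel relabel \<and>
     species
       (comp_E_plus rigid_interval_orders :: 'a set \<Rightarrow> ('a set set \<times> 'a set rel) set)
       (comp_E_plus rigid_interval_orders :: 'b set \<Rightarrow> ('b set set \<times> 'b set rel) set)
       (comp_E_plus rigid_interval_orders :: 'c set \<Rightarrow> ('c set set \<times> 'c set rel) set)
       (comp_E_plus_transport relabel) (comp_E_plus_transport relabel)
       (comp_E_plus_transport relabel) (comp_E_plus_transport relabel) \<and>
     natural_isomorphism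
       (interval_orders :: 'a set \<Rightarrow> 'a rel set)
       (interval_orders :: 'b set \<Rightarrow> 'b rel set)
       relabel
       (comp_E_plus rigid_interval_orders)
       (comp_E_plus rigid_interval_orders)
       (comp_E_plus_transport relabel)
       class_decomposition class_decomposition"
proof (intro conjI)
  show "species
       (interval_orders :: 'a set \<Rightarrow> 'a rel set)
       (interval_orders :: 'b set \<Rightarrow> 'b rel set)
       (interval_orders :: 'c set \<Rightarrow> 'c rel set)
       relabel relabel relabel relabel"
    by (intro species_relations relabel_interval_orders) (auto simp: interval_orders_def)
  show "species
       (rigid_interval_orders :: 'a set \<Rightarrow> 'a rel set)
       (rigid_interval_orders :: 'b set \<Rightarrow> 'b rel set)
       (rigid_interval_orders :: 'c set \<Rightarrow> 'c rel set)
       relabel relabel relabel relabel"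
    by (intro species_relations relabel_rigid_interval_orders)
      (auto simp: rigid_interval_orders_def interval_orders_def)
  show "species
       (comp_E_plus rigid_interval_orders :: 'a set \<Rightarrow> ('a set set \<times> 'a set rel) set)
       (comp_E_plus rigid_interval_orders :: 'b set \<Rightarrow> ('b set set \<times> 'b set rel) set)
       (comp_E_plus rigid_interval_orders :: 'c set \<Rightarrow> ('c set set \<times> 'c set rel) set)
       (comp_E_plus_transport relabel) (comp_E_plus_transport relabel)
       (comp_E_plus_transport relabel) (comp_E_plus_transport relabel)"
    by (intro species_comp_E_plus species_relations relabel_rigid_interval_orders)
      (auto simp: rigid_interval_orders_def interval_orders_def)
  show "natural_isomorphism
       (interval_orders :: 'a set \<Rightarrow> 'a rel set)
       (interval_orders :: 'b set \<Rightarrow> 'b rel set)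
       relabel
       (comp_E_plus rigid_interval_orders)
       (comp_E_plus rigid_interval_orders)
       (comp_E_plus_transport relabel)
       class_decomposition class_decomposition"
    unfolding natural_isomorphism_def
    by (auto simp: interval_orders_iff
        intro!: bij_betw_class_decomposition class_decomposition_relabel)
qed

end
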